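(* Let $f \in \mathbb{R}[x]$ be a univariate polynomial of degree $2d$ that is nonnegative on $\mathbb{R}$, and write $$f(x)=(x-r_1)^{2e_1}(x-r_2)^{2e_2}\cdots (x-r_k)^{2e_k}\, g(x)$$ with $r_i \in \mathbb{R}$, $e_i \in \mathbb{N}$, $e=\sum_i e_i$, and $g$ a polynomial of degree $2(d-e)$ with $g(x)>0$ for all $x \in \mathbb{R}$. Then $\mathrm{Gram}_{\succeq 0}(f)$ and $\mathrm{Gram}_{\succeq 0}(g)$ are affinely isomorphic: $$\mathrm{Gram}_{\succeq 0}(f) \simeq \mathrm{Gram}_{\succeq 0}(g).$$ In particular, $$\dim \mathrm{Gram}_{\succeq 0}(f)=\dim \mathrm{Gram}_{\succeq 0}(g)=\binom{d-e}{2}.$$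
   Context: For a univariate polynomial $h$ of degree $2m$, let $X=(1,x,\ldots,x^m)^t$ be the vector of monomials of degree up to $m$. The set of Gram matrices of $h$ is $\mathrm{Gram}(h)=\{Q : Q \text{ is a real symmetric } (m+1)\times(m+1) \text{ matrix with } h = X^t Q X\}$, where the equality is one of polynomials. The Gram spectrahedron of $h$ is $\mathrm{Gram}_{\succeq 0}(h)=\{Q \in \mathrm{Gram}(h) : Q \succeq 0\}$, where $Q\succeq 0$ means positive semidefinite. The dimension of a nonempty convex set is the dimension of its affine hull. Two convex sets are affinely isomorphic if there is a bijection between them that is the restriction of an affine map between the ambient vector spaces. By convention $\binom{0}{2}=\binom{1}{2}=0$. *)

theory Defs
  imports "HOL-Analysis.Analysis" "HOL-Computational_Algebra.Polynomial"
begin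

text \<open>
  Matrices of size \<open>(m+1) \<times> (m+1)\<close> have type \<^typ>\<open>real ^ 'n ^ 'n\<close> with \<open>CARD('n) = m + 1\<close>. The index
  type is linearly ordered, so that the index \<open>i\<close> corresponds to the exponent given by its position,
  counted from \<open>0\<close>.
\<close>

definition exponent :: "'n::{finite,linorder} \<Rightarrow> nat" where
  "exponent i = card {j. j < i}"

lemma bij_betw_exponent:
  "bij_betw exponent (UNIV :: 'n::{finite,linorder} set) {..<CARD('n)}"
proof -
  have mono: "strict_mono (exponent :: 'n \<Rightarrow> nat)"
    unfolding strict_mono_def exponent_def by (auto intro!: psubset_card_mono)
  have inj: "inj (exponent :: 'n \<Rightarrow> nat)"
    using mono by (rule strict_mono_imp_inj_on)
  have "range (exponent :: 'n \<Rightarrow> nat) \<subseteq> {..<CARD('n)}"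
    unfolding exponent_def by (auto intro!: psubset_card_mono)
  moreover have "card (range (exponent :: 'n \<Rightarrow> nat)) = card {..<CARD('n)}"
    using inj by (simp add: card_image)
  ultimately have "range (exponent :: 'n \<Rightarrow> nat) = {..<CARD('n)}"
    by (intro card_subset_eq) auto
  with inj show ?thesis by (simp add: bij_betw_def)
qed

definition monomial_vec :: "real poly ^ 'n::{finite,linorder}" where
  "monomial_vec = (\<chi> i. monom 1 (exponent i))"

text \<open>
  The matrix size is determined by the type; it is the intended one for \<open>h\<close> of degree \<open>2 * m\<close> when
  \<open>CARD('n) = m + 1\<close>. The equation is one of polynomials, so the entries of \<open>Q\<close> occur as constant
  polynomials.
\<close>

definition Gram :: "real poly \<Rightarrow> (real ^ 'n::{finite,linorder} ^ 'n::{finite,linorder}) set" where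
  "Gram h = {Q. transpose Q = Q \<and>
     h = (\<Sum>i\<in>UNIV. \<Sum>j\<in>UNIV. monomial_vec $ i * [:Q $ i $ j:] * monomial_vec $ j)}"

definition pos_semidef :: "real ^ 'n ^ 'n \<Rightarrow> bool" where
  "pos_semidef Q \<longleftrightarrow> transpose Q = Q \<and> (\<forall>v. 0 \<le> v \<bullet> (Q *v v))"

definition Gram_psd :: "real poly \<Rightarrow> (real ^ 'n::{finite,linorder} ^ 'n::{finite,linorder}) set" where
  "Gram_psd h = {Q \<in> Gram h. pos_semidef Q}"

definition affinely_isomorphic :: "'a::real_vector set \<Rightarrow> 'b::real_vector set \<Rightarrow> bool" where
  "affinely_isomorphic S T \<longleftrightarrow> (\<exists>L c. linear L \<and> bij_betw (\<lambda>x. L x + c) S T)"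

end

theory Submission
  imports Defs "HOL-Computational_Algebra.Fundamental_Theorem_Algebra"
begin

text \<open>
  Write \<open>f = F\<^sup>2 g\<close> with \<open>F\<close> the product of the \<open>(x - r\<^sub>i)\<^bsup>e\<^sub>i\<^esup>\<close>, and let \<open>M\<close> be the matrix of
  multiplication by \<open>F\<close> in the monomial bases. Substituting \<open>M\<^sup>t X = F X\<close> shows that \<open>P \<mapsto> M P M\<^sup>t\<close>
  sends Gram matrices of \<open>g\<close> to Gram matrices of \<open>f\<close> and preserves semidefiniteness; it is linear
  and injective because \<open>M\<close> is. The point is surjectivity. If \<open>Q\<close> is a semidefinite Gram matrix of \<open>f\<close>
  and \<open>q = (Q w, X)\<close> is the polynomial with coefficient vector \<open>Q w\<close>, then Cauchy-Schwarz for the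
  form \<open>Q\<close> gives \<open>q(x)\<^sup>2 \<le> (w, Q w) f(x)\<close> for all real \<open>x\<close>. Cancelling linear factors one after the
  other, such a bound forces \<open>F\<close> to divide \<open>q\<close> (\<open>dvd_by_bound_real_rooted\<close>). Hence the range of \<open>Q\<close>
  lies in the range of \<open>M\<close> (\<open>range_Gram_psd_subset\<close>), and with a left inverse \<open>N\<close> of \<open>M\<close> the matrix
  \<open>N Q N\<^sup>t\<close> is the required preimage (\<open>Gram_psd_compress\<close>).

  For the dimension, let \<open>g\<close> be positive of degree \<open>2 m\<close>. It has a positive definite Gram matrix
  (\<open>pos_poly_pos_def_Gram\<close>): \<open>g - \<epsilon> (1 + x\<^sup>2 + \<dots> + x\<^bsup>2m\<^esup>)\<close> is still nonnegative for some \<open>\<epsilon> > 0\<close>, so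
  it is a sum of squares and has a semidefinite Gram matrix, to which \<open>\<epsilon>\<close> times the identity is
  added. Around this point the semidefinite Gram matrices fill a neighbourhood in the affine space of
  all Gram matrices of \<open>g\<close>, whose direction is the space of Gram matrices of \<open>0\<close>. That space is the
  orthogonal complement of an explicit orthogonal family: \<open>2 m + 1\<close> Hankel matrices, one for each
  coefficient that has to vanish, and \<open>(m + 1) m / 2\<close> antisymmetric matrices. So its dimension is
  \<open>(m + 1)\<^sup>2 - (2 m + 1) - (m + 1) m / 2 = m (m - 1) / 2\<close> (\<open>dim_Gram_zero\<close>).
\<close>

section \<open>Univariate polynomials that are nonnegative on the real line\<close>

text \<open>
  At a zero of \<open>F\<close> nothing is known about \<open>h\<close> directly, but \<open>h\<close> is continuous and the zeros of
  \<open>F\<close> are finite in number, hence cannot fill an open set on which \<open>h\<close> is negative.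
\<close>

lemma nonneg_cancel_square:
  fixes F h :: "real poly"
  assumes "F \<noteq> 0" and nonneg: "\<And>x. 0 \<le> poly (F\<^sup>2 * h) x"
  shows "0 \<le> poly h x"
proof (rule ccontr)
  assume "\<not> 0 \<le> poly h x"
  then have x: "x \<in> {y. poly h y < 0}" by simp
  have "{y. poly h y < 0} \<subseteq> {y. poly F y = 0}"
    using nonneg by (force simp: zero_le_mult_iff)
  then have "finite {y. poly h y < 0}"
    using \<open>F \<noteq> 0\<close> poly_roots_finite finite_subset by blast
  moreover have "open {y. poly h y < 0}"
    by (intro open_Collect_less continuous_intros)
  ultimately show False
    using finite_imp_not_open x by blast
qed

lemma nonneg_poly_attains_min:
  fixes p :: "real poly"
  assumes nonneg: "\<And>x. 0 \<le> poly p x" and "degree p > 0"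
  obtains x\<^sub>0 where "\<And>x. poly p x\<^sub>0 \<le> poly p x"
proof -
  obtain a q where p: "p = pCons a q" by (cases p)
  with \<open>degree p > 0\<close> have "q \<noteq> 0" by (auto split: if_splits)
  from poly_infinity[OF this, of "poly p 0" a] p nonneg
  obtain R where R: "\<And>z. R \<le> \<bar>z\<bar> \<Longrightarrow> poly p 0 \<le> poly p z"
    by auto
  have "continuous_on (cball 0 \<bar>R\<bar>) (poly p)"
    by (intro continuous_intros)
  then obtain x\<^sub>0 where x0: "\<And>x. x \<in> cball 0 \<bar>R\<bar> \<Longrightarrow> poly p x\<^sub>0 \<le> poly p x"
    using continuous_attains_inf[of "cball 0 \<bar>R\<bar>" "poly p"]
    by (metis abs_ge_zero cball_eq_empty compact_cball not_le)
  have "poly p x\<^sub>0 \<le> poly p x" for x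
  proof (cases "\<bar>x\<bar> \<le> \<bar>R\<bar>")
    case True
    then show ?thesis by (intro x0) simp
  next
    case False
    then have "R \<le> \<bar>x\<bar>" by linarith
    with R have "poly p 0 \<le> poly p x" .
    moreover have "poly p x\<^sub>0 \<le> poly p 0" by (intro x0) simp
    ultimately show ?thesis by linarith
  qed
  then show thesis by (rule that)
qed

text \<open>
  Subtracting the minimal value \<open>c\<close>, attained at \<open>x\<^sub>0\<close>, creates a zero at which the derivative
  vanishes too. So \<open>p = c + (x - x\<^sub>0)\<^sup>2 s\<close> with \<open>s\<close> nonnegative of smaller degree, hence a sum of
  squares by induction, and \<open>c = (sqrt c)\<^sup>2\<close>.
\<close>

lemma nonneg_poly_sum_of_squares:
  fixes p :: "real poly"
  assumes "\<And>x. 0 \<le> poly p x"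
  shows "\<exists>qs. p = (\<Sum>q\<leftarrow>qs. q\<^sup>2) \<and> (\<forall>q\<in>set qs. 2 * degree q \<le> degree p)"
  using assms
proof (induction "degree p" arbitrary: p rule: less_induct)
  case less
  show ?case
  proof (cases "degree p = 0")
    case True
    then obtain c where p: "p = [:c:]" by (rule degree_eq_zeroE)
    with less.prems[of 0] have "c \<ge> 0" by simp
    then have "p = (\<Sum>q\<leftarrow>[[:sqrt c:]]. q\<^sup>2)"
      using p by (simp add: power2_eq_square)
    then show ?thesis by (intro exI[of _ "[[:sqrt c:]]"]) auto
  next
    case False
    then obtain x\<^sub>0 where x0: "\<And>x. poly p x\<^sub>0 \<le> poly p x"
      using nonneg_poly_attains_min less.prems by blast
    define c where "c = poly p x\<^sub>0"
    have "c \<ge> 0" unfolding c_def by (rule less.prems)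
    have "poly (p - [:c:]) x\<^sub>0 = 0" by (simp add: c_def)
    then obtain u where u: "p - [:c:] = [:- x\<^sub>0, 1:] * u"
      unfolding poly_eq_0_iff_dvd ..
    have "poly (pderiv (p - [:c:])) x\<^sub>0 = 0"
    proof (rule DERIV_local_min)
      show "DERIV (poly (p - [:c:])) x\<^sub>0 :> poly (pderiv (p - [:c:])) x\<^sub>0"
        by (rule poly_DERIV)
      show "0 < (1::real)" by simp
      show "\<forall>y. \<bar>x\<^sub>0 - y\<bar> < 1 \<longrightarrow> poly (p - [:c:]) x\<^sub>0 \<le> poly (p - [:c:]) y"
        using x0 by simp
    qed
    then have "poly u x\<^sub>0 = 0"
      unfolding u pderiv_mult by (simp add: pderiv_pCons)
    then obtain s where "u = [:- x\<^sub>0, 1:] * s"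
      unfolding poly_eq_0_iff_dvd ..
    with u have s: "p - [:c:] = [:- x\<^sub>0, 1:]\<^sup>2 * s"
      by (simp only: power2_eq_square mult.assoc)
    have s_nonneg: "0 \<le> poly s x" for x
    proof (rule nonneg_cancel_square)
      show "[:- x\<^sub>0, 1:] \<noteq> 0" by simp
      show "0 \<le> poly ([:- x\<^sub>0, 1:]\<^sup>2 * s) x" for x
        unfolding s[symmetric] using x0 by (simp add: c_def)
    qed
    from s have p: "p = [:c:] + [:- x\<^sub>0, 1:]\<^sup>2 * s" by (simp add: algebra_simps)
    have "s \<noteq> 0" using False p by auto
    have "degree (p - [:c:]) = degree p"
      unfolding diff_conv_add_uminus using False by (intro degree_add_eq_left) simp
    moreover have "degree ([:- x\<^sub>0, 1:]\<^sup>2 * s) = 2 + degree s"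
      using \<open>s \<noteq> 0\<close> by (simp add: degree_mult_eq degree_power_eq)
    ultimately have deg: "degree p = 2 + degree s" using s by simp
    obtain qs where qs: "s = (\<Sum>q\<leftarrow>qs. q\<^sup>2)" "\<And>q. q \<in> set qs \<Longrightarrow> 2 * degree q \<le> degree s"
      using less.hyps[of s] deg s_nonneg by auto
    let ?qs = "[:sqrt c:] # map ((*) [:- x\<^sub>0, 1:]) qs"
    have "l\<^sup>2 * s = (\<Sum>q\<leftarrow>map ((*) l) qs. q\<^sup>2)" for l
      unfolding qs(1) by (simp add: sum_list_const_mult comp_def power_mult_distrib)
    moreover have "[:sqrt c:]\<^sup>2 = [:c:]"
      using \<open>c \<ge> 0\<close> by (simp add: power2_eq_square)
    ultimately have "p = (\<Sum>q\<leftarrow>?qs. q\<^sup>2)" using p by simp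
    moreover have "2 * degree ([:- x\<^sub>0, 1:] * q) \<le> degree p" if "q \<in> set qs" for q
      using degree_mult_le[of "[:- x\<^sub>0, 1:]" q] qs(2)[OF that] deg by simp
    then have "\<forall>q\<in>set ?qs. 2 * degree q \<le> degree p" by auto
    ultimately show ?thesis by blast
  qed
qed

text \<open>
  On \<open>[-1, 1]\<close> the bound is compactness. For \<open>\<bar>x\<bar> \<ge> 1\<close>, the substitution \<open>x \<mapsto> 1 / x\<close> turns \<open>g\<close>
  into its reversed polynomial, which is positive on \<open>[-1, 1]\<close> as well: its value at \<open>0\<close> is the
  leading coefficient of \<open>g\<close>.
\<close>

lemma pos_poly_ge_sum_even_powers:
  fixes g :: "real poly"
  assumes pos: "\<And>x. 0 < poly g x" and deg: "degree g = 2 * m"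
  obtains \<epsilon> where "\<epsilon> > 0" "\<And>x. \<epsilon> * (\<Sum>i\<le>m. x ^ (2 * i)) \<le> poly g x"
proof -
  let ?h = "reflect_poly g"
  have "g \<noteq> 0" using pos[of 0] by auto
  have refl: "poly ?h x = x ^ (2 * m) * poly g (inverse x)" if "x \<noteq> 0" for x
    using poly_reflect_poly_nz[OF that] deg by simp
  have refl_nonneg: "0 \<le> poly ?h x" for x
  proof (rule nonneg_cancel_square)
    show "[:0, 1::real:] \<noteq> 0" by simp
    show "0 \<le> poly ([:0, 1:]\<^sup>2 * ?h) x" for x
      using refl[of x] pos[of "inverse x"] by (cases "x = 0") (auto simp: power_mult)
  qed
  have refl_pos: "0 < poly ?h x" for x
  proof (cases "x = 0")
    case True
    have "poly ?h 0 \<noteq> 0" using \<open>g \<noteq> 0\<close> by simp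
    with refl_nonneg[of 0] True show ?thesis by (simp add: less_le)
  next
    case False
    then show ?thesis using refl pos by (simp add: power_mult zero_less_power)
  qed
  have lower: "\<exists>\<delta>>0. \<forall>x. \<bar>x\<bar> \<le> 1 \<longrightarrow> \<delta> \<le> poly p x" if "\<And>x. 0 < poly p x" for p :: "real poly"
  proof -
    have "continuous_on (cball 0 1) (poly p)" by (intro continuous_intros)
    then obtain y where "\<And>x. x \<in> cball 0 1 \<Longrightarrow> poly p y \<le> poly p x"
      using continuous_attains_inf[of "cball 0 1" "poly p"]
      by (metis cball_eq_empty compact_cball not_one_less_zero)
    then show ?thesis using that[of y] by (intro exI[of _ "poly p y"]) auto
  qed
  obtain \<delta> where \<delta>: "\<delta> > 0" "\<And>x. \<bar>x\<bar> \<le> 1 \<Longrightarrow> \<delta> \<le> poly g x"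
    using lower[of g] pos by blast
  obtain \<delta>' where \<delta>': "\<delta>' > 0" "\<And>x. \<bar>x\<bar> \<le> 1 \<Longrightarrow> \<delta>' \<le> poly ?h x"
    using lower[of ?h] refl_pos by blast
  (* each of the m + 1 powers is at most 1 inside the unit interval and at most x^(2m) outside *)
  define \<epsilon> where "\<epsilon> = min \<delta> \<delta>' / (m + 1)"
  have \<epsilon>: "\<epsilon> > 0" "\<epsilon> * (m + 1) \<le> \<delta>" "\<epsilon> * (m + 1) \<le> \<delta>'"
    using \<delta> \<delta>' by (auto simp: \<epsilon>_def)
  have "\<epsilon> * (\<Sum>i\<le>m. x ^ (2 * i)) \<le> poly g x" for x
  proof (cases "\<bar>x\<bar> \<le> 1")
    case True
    then have "x\<^sup>2 \<le> 1" by (simp add: abs_square_le_1)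
    then have "(\<Sum>i\<le>m. x ^ (2 * i)) \<le> (\<Sum>i\<le>m. 1)"
      by (intro sum_mono) (simp add: power_mult power_le_one)
    then have "\<epsilon> * (\<Sum>i\<le>m. x ^ (2 * i)) \<le> \<epsilon> * (m + 1)"
      using \<epsilon>(1) by (intro mult_left_mono) auto
    then show ?thesis using \<epsilon>(2) \<delta>(2)[OF True] by linarith
  next
    case False
    then have x: "x \<noteq> 0" "\<bar>inverse x\<bar> \<le> 1"
      by (auto simp: inverse_le_1_iff)
    from False have "1 \<le> x\<^sup>2" by (simp add: abs_square_less_1 flip: not_less)
    from \<open>1 \<le> x\<^sup>2\<close> have "(\<Sum>i\<le>m. x ^ (2 * i)) \<le> (\<Sum>i\<le>m. x ^ (2 * m))"
      by (intro sum_mono) (simp add: power_mult power_increasing)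
    also have "\<dots> = (m + 1) * x ^ (2 * m)" by simp
    finally have "\<epsilon> * (\<Sum>i\<le>m. x ^ (2 * i)) \<le> \<epsilon> * ((m + 1) * x ^ (2 * m))"
      using \<epsilon>(1) by (intro mult_left_mono) auto
    also have "\<dots> = (\<epsilon> * (m + 1)) * x ^ (2 * m)" by (simp add: mult.assoc)
    also have "\<dots> \<le> poly ?h (inverse x) * x ^ (2 * m)"
      using \<epsilon>(3) \<delta>'(2)[OF x(2)]
      by (intro mult_right_mono order_trans[OF \<epsilon>(3)]) (auto simp: power_mult)
    also have "\<dots> = poly g x"
      using refl[of "inverse x"] x(1) by (simp add: field_simps)
    finally show ?thesis .
  qed
  with \<epsilon>(1) show thesis by (rule that)
qed

section \<open>Divisibility forced by a pointwise bound\<close>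

text \<open>
  The bound controls the multiplicity of a zero of \<open>F\<close> in \<open>q\<close>, not only its presence. The factor \<open>h\<close>
  is arbitrary so that, for a product, it can absorb the square of the other factor.
\<close>

definition dvd_by_bound :: "real poly \<Rightarrow> bool" where
  "dvd_by_bound F \<longleftrightarrow> F \<noteq> 0 \<and> (\<forall>q h. (\<forall>x. (poly q x)\<^sup>2 \<le> poly (F\<^sup>2 * h) x) \<longrightarrow> F dvd q)"

lemma dvd_by_bound_linear: "dvd_by_bound [:- r, 1:]"
  unfolding dvd_by_bound_def
proof (intro conjI allI impI)
  show "[:- r, 1:] dvd q" if "\<forall>x. (poly q x)\<^sup>2 \<le> poly ([:- r, 1:]\<^sup>2 * h) x" for q h
    using that[rule_format, of r] by (simp add: poly_eq_0_iff_dvd)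
qed simp

text \<open>
  After extracting \<open>F\<close> from \<open>q\<close>, the factor \<open>F\<^sup>2\<close> can be cancelled from the bound, and what remains is
  a bound of the same shape for \<open>G\<close>.
\<close>

lemma dvd_by_bound_mult:
  assumes F: "dvd_by_bound F" and G: "dvd_by_bound G"
  shows "dvd_by_bound (F * G)"
  unfolding dvd_by_bound_def
proof (intro conjI allI impI)
  show "F * G \<noteq> 0" using F G by (simp add: dvd_by_bound_def)
  fix q h assume bound: "\<forall>x. (poly q x)\<^sup>2 \<le> poly ((F * G)\<^sup>2 * h) x"
  then have "F dvd q"
    using F unfolding dvd_by_bound_def power_mult_distrib mult.assoc by blast
  then obtain q' where q: "q = F * q'" ..
  have "0 \<le> poly (G\<^sup>2 * h - q'\<^sup>2) x" for x
  proof (rule nonneg_cancel_square)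
    show "F \<noteq> 0" using F by (simp add: dvd_by_bound_def)
    show "0 \<le> poly (F\<^sup>2 * (G\<^sup>2 * h - q'\<^sup>2)) x" for x
      using bound[rule_format, of x] by (simp add: q algebra_simps power_mult_distrib)
  qed
  then have "\<forall>x. (poly q' x)\<^sup>2 \<le> poly (G\<^sup>2 * h) x" by simp
  then have "G dvd q'"
    using G unfolding dvd_by_bound_def by blast
  then show "F * G dvd q" by (simp add: q)
qed

lemma dvd_by_bound_real_rooted: "dvd_by_bound (\<Prod>i\<in>I. [:- r i, 1:] ^ n i)"
proof -
  have one: "dvd_by_bound 1" by (simp add: dvd_by_bound_def)
  have "dvd_by_bound ([:- a, 1:] ^ k)" for a k
    by (induction k) (simp_all only: power_0 power_Suc one dvd_by_bound_mult dvd_by_bound_linear)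
  then show ?thesis
    by (induction I rule: infinite_finite_induct) (simp_all add: one dvd_by_bound_mult)
qed

section \<open>Coefficient vectors and quadratic forms\<close>

definition monomials :: "real \<Rightarrow> real ^ 'n::{finite,linorder}" where
  "monomials x = (\<chi> i. x ^ exponent i)"

definition vec_poly :: "real ^ 'n::{finite,linorder} \<Rightarrow> real poly" where
  "vec_poly v = (\<Sum>i\<in>UNIV. monom (v $ i) (exponent i))"

definition coeff_vec :: "real poly \<Rightarrow> real ^ 'n::{finite,linorder}" where
  "coeff_vec p = (\<chi> i. coeff p (exponent i))"

definition gram_poly :: "real ^ 'n::{finite,linorder} ^ 'n::{finite,linorder} \<Rightarrow> real poly" where
  "gram_poly Q = (\<Sum>i\<in>UNIV. \<Sum>j\<in>UNIV. monom (Q $ i $ j) (exponent i + exponent j))"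

lemma exponent_less: "exponent (i :: 'n::{finite,linorder}) < CARD('n)"
  using bij_betwE[OF bij_betw_exponent] by blast

lemma exponent_eq_iff: "exponent i = exponent j \<longleftrightarrow> i = j"
  using bij_betw_imp_inj_on[OF bij_betw_exponent] by (auto dest: injD)

lemma exponent_onto:
  assumes "k < CARD('n::{finite,linorder})"
  obtains i :: "'n::{finite,linorder}" where "exponent i = k"
proof -
  have "k \<in> range (exponent :: 'n \<Rightarrow> nat)"
    using assms by (simp add: bij_betw_imp_surj_on[OF bij_betw_exponent])
  then show thesis using that by blast
qed

lemma sum_exponent: "(\<Sum>i\<in>(UNIV :: 'n::{finite,linorder} set). h (exponent i)) = (\<Sum>k<CARD('n). h k)"
  by (rule sum.reindex_bij_betw[OF bij_betw_exponent])

lemma poly_vec_poly: "poly (vec_poly v) x = v \<bullet> monomials x"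
  by (simp add: vec_poly_def monomials_def inner_vec_def poly_sum poly_monom)

lemma coeff_vec_poly: "coeff (vec_poly v) (exponent i) = v $ i"
  by (simp add: vec_poly_def coeff_sum exponent_eq_iff)

lemma vec_poly_add: "vec_poly (v + w) = vec_poly v + vec_poly w"
  by (simp add: vec_poly_def add_monom[symmetric] sum.distrib)

lemma poly_ext: "(\<And>x. poly p x = poly q x) \<Longrightarrow> p = q" for p q :: "real poly"
  by (rule poly_eq_poly_eq_iff[THEN iffD1]) (rule ext)

lemma vec_poly_scaleR: "vec_poly (c *\<^sub>R v) = smult c (vec_poly v)"
  by (rule poly_ext) (simp add: poly_vec_poly)

lemma vec_poly_inject: "vec_poly v = vec_poly w \<longleftrightarrow> v = w"
  by (metis coeff_vec_poly vec_eq_iff)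

lemma degree_vec_poly: "degree (vec_poly (v :: real ^ 'n::{finite,linorder})) < CARD('n)"
proof -
  have "exponent i \<le> CARD('n) - 1" for i :: 'n
    using exponent_less[of i] by linarith
  then have "degree (vec_poly v) \<le> CARD('n) - 1"
    unfolding vec_poly_def by (intro degree_sum_le order_trans[OF degree_monom_le]) auto
  then show ?thesis using zero_less_card_finite[where 'a = 'n] by linarith
qed

lemma vec_poly_coeff_vec:
  assumes "degree p < CARD('n::{finite,linorder})"
  shows "vec_poly (coeff_vec p :: real ^ 'n::{finite,linorder}) = p"
proof -
  have "vec_poly (coeff_vec p :: real ^ 'n::{finite,linorder}) = (\<Sum>k<CARD('n). monom (coeff p k) k)"
    unfolding vec_poly_def coeff_vec_def by (simp add: sum_exponent[of "\<lambda>k. monom (coeff p k) k"])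
  also have "\<dots> = (\<Sum>k\<le>degree p. monom (coeff p k) k)"
    using assms by (intro sum.mono_neutral_right) (auto simp: coeff_eq_0 not_le)
  also have "\<dots> = p" by (rule poly_as_sum_of_monoms)
  finally show ?thesis .
qed

lemma poly_gram_poly: "poly (gram_poly Q) x = monomials x \<bullet> (Q *v monomials x)"
  unfolding gram_poly_def poly_sum poly_monom monomials_def inner_vec_def
    matrix_vector_mult_def vec_lambda_beta inner_real_def sum_distrib_left power_add
  by (intro sum.cong refl) (simp only: mult_ac)

lemma Gram_iff_gram_poly: "Q \<in> Gram h \<longleftrightarrow> transpose Q = Q \<and> h = gram_poly Q"
proof -
  have "monom 1 a * [:c:] * monom 1 b = monom c (a + b)" for a b and c :: real
    by (simp only: monom_0[symmetric] mult_monom mult_1_left mult_1_right add_0_right)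
  then show ?thesis by (simp add: Gram_def gram_poly_def monomial_vec_def)
qed

lemma Gram_iff:
  "Q \<in> Gram h \<longleftrightarrow> transpose Q = Q \<and> (\<forall>x. poly h x = monomials x \<bullet> (Q *v monomials x))"
  unfolding Gram_iff_gram_poly by (auto simp: poly_gram_poly intro: poly_ext)

lemma symmetric_form:
  fixes Q :: "real ^ 'n ^ 'n"
  assumes "transpose Q = Q"
  shows "v \<bullet> (Q *v w) = w \<bullet> (Q *v v)"
proof -
  have "v v* Q = Q *v v"
    using transpose_matrix_vector[of Q v] unfolding assms by (rule sym)
  then have "v \<bullet> (Q *v w) = (Q *v v) \<bullet> w"
    using dot_lmul_matrix[of v Q w] by simp
  then show ?thesis by (simp add: inner_commute)
qed

text \<open>
  The vector \<open>(v, Q v) w - (w, Q v) v\<close> is orthogonal to \<open>v\<close> for the form, and nonnegativity of the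
  form on it is the claim multiplied by \<open>(v, Q v)\<close>. If that factor vanishes, the roles of \<open>v\<close> and
  \<open>w\<close> are exchanged. If \<open>v\<close> and \<open>w\<close> are both isotropic, the form takes the value \<open>- 2 (w, Q v)\<^sup>2\<close>
  on \<open>w - (w, Q v) v\<close>, which forces \<open>(w, Q v) = 0\<close>.
\<close>

lemma pos_semidef_Cauchy_Schwarz:
  assumes "pos_semidef Q"
  shows "(w \<bullet> (Q *v v))\<^sup>2 \<le> (w \<bullet> (Q *v w)) * (v \<bullet> (Q *v v))"
proof -
  let ?B = "\<lambda>v w. v \<bullet> (Q *v w)"
  have nonneg: "?B u u \<ge> 0" for u using assms by (simp add: pos_semidef_def)
  have sym: "?B u u' = ?B u' u" for u u'
    using assms by (intro symmetric_form) (simp add: pos_semidef_def)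
  have comb: "0 \<le> s\<^sup>2 * ?B w w - 2 * s * t * ?B w v + t\<^sup>2 * ?B v v" for v w and s t :: real
    using nonneg[of "s *\<^sub>R w - t *\<^sub>R v"] sym[of v w]
    by (simp add: matrix_vector_mult_diff_distrib matrix_vector_mult_scaleR inner_diff_left
        inner_diff_right power2_eq_square algebra_simps)
  have main: "(?B w v)\<^sup>2 \<le> ?B w w * ?B v v" if "?B v v > 0" for v w
  proof -
    have "0 \<le> ?B v v * (?B w w * ?B v v - (?B w v)\<^sup>2)"
      using comb[of "?B v v" w "?B w v" v] by (simp add: power2_eq_square algebra_simps)
    with that show ?thesis by (simp add: zero_le_mult_iff)
  qed
  consider "?B v v > 0" | "?B w w > 0" | "?B v v = 0" "?B w w = 0"
    using nonneg[of v] nonneg[of w] by linarith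
  then show ?thesis
  proof cases
    case 1
    then show ?thesis by (rule main)
  next
    case 2
    then show ?thesis using main[of w v] sym[of v w] by (simp add: mult.commute)
  next
    case 3
    then show ?thesis using comb[of 1 w "?B w v" v] by (simp add: power2_eq_square)
  qed
qed

lemma congruence_form:
  fixes M :: "real ^ 'm ^ 'n"
  shows "w \<bullet> ((M ** P ** transpose M) *v w) = (w v* M) \<bullet> (P *v (w v* M))"
  by (simp add: matrix_vector_mul_assoc[symmetric] dot_lmul_matrix)

lemma transpose_congruence:
  fixes M :: "real ^ 'm ^ 'n"
  assumes "transpose P = P"
  shows "transpose (M ** P ** transpose M) = M ** P ** transpose M"
  by (simp add: matrix_transpose_mul assms matrix_mul_assoc)

lemma pos_semidef_congruence:
  fixes M :: "real ^ 'm ^ 'n"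
  assumes "pos_semidef P"
  shows "pos_semidef (M ** P ** transpose M)"
  using assms unfolding pos_semidef_def congruence_form by (simp add: transpose_congruence)

lemma linear_congruence:
  fixes M :: "real ^ 'm ^ 'n"
  shows "linear (\<lambda>P. M ** P ** transpose M)"
proof (rule linearI)
  have "(A + B) ** C = A ** C + B ** C" for A B :: "real ^ 'm ^ 'n" and C :: "real ^ 'n ^ 'm"
    by (simp add: matrix_matrix_mult_def vec_eq_iff sum.distrib distrib_right)
  then show "M ** (P + P') ** transpose M = M ** P ** transpose M + M ** P' ** transpose M" for P P'
    by (simp add: matrix_add_ldistrib)
  show "M ** (c *\<^sub>R P) ** transpose M = c *\<^sub>R (M ** P ** transpose M)" for c P
    by (simp add: matrix_scalar_ac scalar_matrix_assoc)
qed

section \<open>Splitting off a real-rooted square\<close>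

text \<open>Multiplication by \<open>F\<close>, written in the monomial bases.\<close>

definition mult_matrix :: "real poly \<Rightarrow> real ^ 'm::{finite,linorder} ^ 'n::{finite,linorder}" where
  "mult_matrix F = matrix (\<lambda>v. coeff_vec (F * vec_poly v))"

context
  fixes F :: "real poly" and M :: "real ^ 'm::{finite,linorder} ^ 'n::{finite,linorder}"
  assumes card: "CARD('n) = CARD('m) + degree F"
  defines "M \<equiv> mult_matrix F"
begin

lemma vec_poly_mult_matrix: "vec_poly (M *v v) = F * vec_poly v"
proof -
  have "linear (\<lambda>v :: real ^ 'm::{finite,linorder}. coeff_vec (F * vec_poly v) :: real ^ 'n::{finite,linorder})"
    by (rule linearI) (simp_all add: vec_eq_iff coeff_vec_def vec_poly_add vec_poly_scaleR distrib_left)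
  then have "M *v v = coeff_vec (F * vec_poly v)"
    unfolding M_def mult_matrix_def by (simp add: matrix_works linear_matrix_vector_mul_eq)
  moreover have "degree (F * vec_poly v) < CARD('n)"
    using degree_mult_le[of F "vec_poly v"] degree_vec_poly[of v] card by linarith
  ultimately show ?thesis by (simp add: vec_poly_coeff_vec)
qed

lemma monomials_mult_matrix: "monomials x v* M = poly F x *\<^sub>R monomials x"
proof -
  have "v \<bullet> (monomials x v* M) = v \<bullet> (poly F x *\<^sub>R monomials x)" for v
  proof -
    have "v \<bullet> (monomials x v* M) = (M *v v) \<bullet> monomials x"
      using dot_lmul_matrix[of "monomials x" M v] by (simp only: inner_commute)
    also have "\<dots> = poly F x * (v \<bullet> monomials x)"
      by (simp flip: poly_vec_poly add: vec_poly_mult_matrix)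
    finally show ?thesis by simp
  qed
  then show ?thesis using vector_eq_ldot by blast
qed

lemma gram_poly_congruence: "gram_poly (M ** P ** transpose M) = F\<^sup>2 * gram_poly P"
proof (rule poly_ext)
  show "poly (gram_poly (M ** P ** transpose M)) x = poly (F\<^sup>2 * gram_poly P) x" for x
    unfolding poly_gram_poly congruence_form monomials_mult_matrix
    by (simp add: matrix_vector_mult_scaleR poly_gram_poly power2_eq_square)
qed

lemma inj_mult_matrix:
  assumes "F \<noteq> 0"
  shows "inj ((*v) M)"
proof (rule injI)
  fix v w assume "M *v v = M *v w"
  then have "F * vec_poly v = F * vec_poly w"
    by (simp flip: vec_poly_mult_matrix)
  with assms show "v = w" by (simp add: vec_poly_inject)
qed

text \<open>
  For every \<open>w\<close>, Cauchy-Schwarz for the semidefinite form bounds the square of the polynomial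
  \<open>x \<mapsto> (Q w, X)\<close> by a constant times \<open>(X, Q X) = F\<^sup>2 g\<close>, and such a bound forces divisibility by \<open>F\<close>.
\<close>

lemma range_Gram_psd_subset:
  assumes F: "dvd_by_bound F" and Q: "Q \<in> Gram_psd (F\<^sup>2 * g)"
  shows "Q *v w \<in> range ((*v) M)"
proof -
  have sym: "transpose Q = Q" and psd: "pos_semidef Q"
    and gram: "\<And>x. poly (F\<^sup>2 * g) x = monomials x \<bullet> (Q *v monomials x)"
    using Q by (auto simp: Gram_psd_def Gram_iff)
  have "(poly (vec_poly (Q *v w)) x)\<^sup>2 \<le> poly (F\<^sup>2 * smult (w \<bullet> (Q *v w)) g) x" for x
  proof -
    have "poly (vec_poly (Q *v w)) x = w \<bullet> (Q *v monomials x)"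
      using symmetric_form[OF sym] by (simp add: poly_vec_poly inner_commute)
    then show ?thesis
      using pos_semidef_Cauchy_Schwarz[OF psd, of w "monomials x"] gram[of x] by simp
  qed
  then have "F dvd vec_poly (Q *v w)"
    using F unfolding dvd_by_bound_def by blast
  then obtain s where s: "vec_poly (Q *v w) = F * s" ..
  have "F \<noteq> 0" using F by (simp add: dvd_by_bound_def)
  have "degree s < CARD('m)"
  proof (cases "s = 0")
    case False
    then show ?thesis
      using degree_vec_poly[of "Q *v w"] \<open>F \<noteq> 0\<close> card by (simp add: s degree_mult_eq)
  qed simp
  then have "vec_poly (M *v coeff_vec s) = vec_poly (Q *v w)"
    by (simp add: vec_poly_mult_matrix vec_poly_coeff_vec s)
  then have "Q *v w = M *v coeff_vec s" by (simp add: vec_poly_inject)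
  then show ?thesis by simp
qed

text \<open>
  Since \<open>M N\<close> is the identity on the range of \<open>M\<close>, which contains the range of \<open>Q\<close>, and \<open>Q\<close> is
  symmetric, compressing \<open>Q\<close> by \<open>N\<close> loses nothing.
\<close>

lemma Gram_psd_compress:
  assumes F: "dvd_by_bound F" and N: "N ** M = mat 1" and Q: "Q \<in> Gram_psd (F\<^sup>2 * g)"
  shows "N ** Q ** transpose N \<in> Gram_psd g"
    and "M ** (N ** Q ** transpose N) ** transpose M = Q"
proof -
  have sym: "transpose Q = Q" and psd: "pos_semidef Q" and gram: "F\<^sup>2 * g = gram_poly Q"
    using Q by (auto simp: Gram_psd_def Gram_iff_gram_poly)
  have "(M ** N ** Q) *v w = Q *v w" for w
  proof -
    obtain v where "Q *v w = M *v v"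
      using range_Gram_psd_subset[OF F Q, of w] by blast
    then have "(M ** N ** Q) *v w = M *v ((N ** M) *v v)"
      by (simp only: matrix_vector_mul_assoc[symmetric])
    with \<open>Q *v w = M *v v\<close> show ?thesis by (simp add: N)
  qed
  then have left: "M ** N ** Q = Q" by (simp add: matrix_eq)
  then have "transpose (M ** N ** Q) = Q" using sym by simp
  then have right: "Q ** transpose N ** transpose M = Q"
    using sym by (simp add: matrix_transpose_mul matrix_mul_assoc)
  show reconstruct: "M ** (N ** Q ** transpose N) ** transpose M = Q"
    using left right by (simp only: matrix_mul_assoc)
  have "F\<^sup>2 * g = F\<^sup>2 * gram_poly (N ** Q ** transpose N)"
    using gram gram_poly_congruence[of "N ** Q ** transpose N"] reconstruct by simp
  moreover have "F \<noteq> 0" using F by (simp add: dvd_by_bound_def)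
  ultimately have "g = gram_poly (N ** Q ** transpose N)" by simp
  then show "N ** Q ** transpose N \<in> Gram_psd g"
    using psd sym by (simp add: Gram_psd_def Gram_iff_gram_poly pos_semidef_congruence transpose_congruence)
qed

lemma Gram_psd_expand:
  assumes "P \<in> Gram_psd g"
  shows "M ** P ** transpose M \<in> Gram_psd (F\<^sup>2 * g)"
proof -
  have P: "transpose P = P" "pos_semidef P" "g = gram_poly P"
    using assms by (auto simp: Gram_psd_def Gram_iff_gram_poly)
  then have "pos_semidef (M ** P ** transpose M)" by (intro pos_semidef_congruence)
  moreover have "transpose (M ** P ** transpose M) = M ** P ** transpose M"
    using P(1) by (rule transpose_congruence)
  ultimately show ?thesis
    by (simp only: Gram_psd_def Gram_iff_gram_poly gram_poly_congruence P(3) mem_Collect_eq)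
qed

lemma affinely_isomorphic_Gram_psd_square_mult:
  assumes F: "dvd_by_bound F"
  shows "affinely_isomorphic (Gram_psd (F\<^sup>2 * g) :: (real ^ 'n::{finite,linorder} ^ 'n::{finite,linorder}) set) (Gram_psd g :: (real ^ 'm::{finite,linorder} ^ 'm::{finite,linorder}) set)" (is ?iso)
    and "aff_dim (Gram_psd (F\<^sup>2 * g) :: (real ^ 'n::{finite,linorder} ^ 'n::{finite,linorder}) set) =
      aff_dim (Gram_psd g :: (real ^ 'm::{finite,linorder} ^ 'm::{finite,linorder}) set)" (is "aff_dim ?Gf = aff_dim ?Gg")
proof -
  have "F \<noteq> 0" using F by (simp add: dvd_by_bound_def)
  then obtain N where N: "N ** M = mat 1"
    using inj_mult_matrix matrix_left_invertible_injective by blast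
  then have "transpose (N ** M) = mat 1" by simp
  then have NT: "transpose M ** transpose N = mat 1" by (simp only: matrix_transpose_mul)
  let ?down = "\<lambda>Q. N ** Q ** transpose N" and ?up = "\<lambda>P. M ** P ** transpose M"
  have down_up: "?down (?up P) = P" for P
  proof -
    have "?down (?up P) = (N ** M) ** P ** (transpose M ** transpose N)"
      by (simp only: matrix_mul_assoc)
    then show ?thesis by (simp add: N NT)
  qed
  have bij: "bij_betw ?down (Gram_psd (F\<^sup>2 * g)) (Gram_psd g)"
    by (rule bij_betw_byWitness[where f' = ?up])
      (auto simp: down_up Gram_psd_expand Gram_psd_compress[OF F N])
  then have "bij_betw (\<lambda>Q. ?down Q + 0) (Gram_psd (F\<^sup>2 * g)) (Gram_psd g)" by simp
  then show ?iso
    unfolding affinely_isomorphic_def using linear_congruence[of N] by blast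
  have "?Gf = ?up ` ?Gg"
  proof
    show "?Gf \<subseteq> ?up ` ?Gg"
    proof
      fix Q assume Q: "Q \<in> ?Gf"
      show "Q \<in> ?up ` ?Gg"
        by (rule image_eqI[where x = "?down Q"]) (use Gram_psd_compress[OF F N Q] in simp_all)
    qed
  qed (auto intro: Gram_psd_expand)
  moreover have "inj ?up" by (rule inj_on_inverseI[where g = ?down]) (rule down_up)
  ultimately show "aff_dim ?Gf = aff_dim ?Gg"
    by (simp only: aff_dim_injective_linear_image[OF linear_congruence])
qed

end

section \<open>A positive definite Gram matrix\<close>

lemma pos_semidef_add: "pos_semidef P \<Longrightarrow> pos_semidef Q \<Longrightarrow> pos_semidef (P + Q)"
  by (simp add: pos_semidef_def transpose_def vec_eq_iff matrix_vector_mult_add_rdistrib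
      inner_add_right)

lemma Gram_psd_zero: "0 \<in> Gram_psd 0"
  by (simp add: Gram_psd_def Gram_iff pos_semidef_def transpose_def vec_eq_iff)

lemma Gram_psd_add: "P \<in> Gram_psd p \<Longrightarrow> Q \<in> Gram_psd q \<Longrightarrow> P + Q \<in> Gram_psd (p + q)"
  by (simp add: Gram_psd_def Gram_iff pos_semidef_add)
    (simp add: transpose_def vec_eq_iff matrix_vector_mult_add_rdistrib inner_add_right)

text \<open>If \<open>v\<close> is the coefficient vector of \<open>q\<close>, then \<open>q\<^sup>2 = (v, X)\<^sup>2\<close> is the form of the rank one matrix
  \<open>v v\<^sup>t\<close>.\<close>

lemma Gram_psd_square:
  assumes "degree q < CARD('n::{finite,linorder})"
  shows "\<exists>Q :: real ^ 'n::{finite,linorder} ^ 'n::{finite,linorder}. Q \<in> Gram_psd (q\<^sup>2)"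
proof -
  define v :: "real ^ 'n::{finite,linorder}" where "v = coeff_vec q"
  define Q :: "real ^ 'n::{finite,linorder} ^ 'n::{finite,linorder}" where "Q = (\<chi> i j. v $ i * v $ j)"
  have Qw: "Q *v w = (v \<bullet> w) *\<^sub>R v" for w
    by (simp add: Q_def vec_eq_iff matrix_vector_mult_def inner_vec_def sum_distrib_left[symmetric] mult_ac)
  have "transpose Q = Q" by (simp add: Q_def transpose_def vec_eq_iff mult.commute)
  moreover have "poly (q\<^sup>2) x = monomials x \<bullet> (Q *v monomials x)" for x
    using poly_vec_poly[of v x] vec_poly_coeff_vec[OF assms]
    by (simp add: Qw v_def inner_commute power2_eq_square)
  moreover have "0 \<le> w \<bullet> (Q *v w)" for w by (simp add: Qw inner_commute)
  ultimately have "Q \<in> Gram_psd (q\<^sup>2)"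
    by (simp add: Gram_psd_def Gram_iff pos_semidef_def)
  then show ?thesis ..
qed

lemma nonneg_poly_Gram_psd_nonempty:
  assumes "\<And>x. 0 \<le> poly p x" and deg: "degree p \<le> 2 * m" and card: "CARD('n::{finite,linorder}) = m + 1"
  shows "\<exists>Q :: real ^ 'n::{finite,linorder} ^ 'n::{finite,linorder}. Q \<in> Gram_psd p"
proof -
  obtain qs where p: "p = (\<Sum>q\<leftarrow>qs. q\<^sup>2)" and qs: "\<forall>q\<in>set qs. 2 * degree q \<le> degree p"
    using nonneg_poly_sum_of_squares assms(1) by blast
  have "\<forall>q\<in>set qs. degree q < CARD('n)" using qs deg card by fastforce
  then have "\<exists>Q :: real ^ 'n::{finite,linorder} ^ 'n::{finite,linorder}. Q \<in> Gram_psd (\<Sum>q\<leftarrow>qs. q\<^sup>2)"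
  proof (induction qs)
    case Nil
    show ?case using Gram_psd_zero by auto
  next
    case (Cons q qs)
    obtain P :: "real ^ 'n::{finite,linorder} ^ 'n::{finite,linorder}" where "P \<in> Gram_psd (q\<^sup>2)"
      using Gram_psd_square[of q] Cons.prems by auto
    moreover obtain Q :: "real ^ 'n::{finite,linorder} ^ 'n::{finite,linorder}" where "Q \<in> Gram_psd (\<Sum>q\<leftarrow>qs. q\<^sup>2)"
      using Cons by auto
    ultimately have "P + Q \<in> Gram_psd (\<Sum>q\<leftarrow>q # qs. q\<^sup>2)"
      by (simp add: Gram_psd_add)
    then show ?case ..
  qed
  then show ?thesis unfolding p .
qed

text \<open>
  The polynomial \<open>g\<close> has room for a small multiple of \<open>1 + x\<^sup>2 + \<dots> + x\<^bsup>2m\<^esup>\<close>, whose Gram matrix is the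
  identity. What remains after subtracting it is still a sum of squares.
\<close>

lemma pos_poly_pos_def_Gram:
  assumes pos: "\<And>x. 0 < poly g x" and deg: "degree g = 2 * m"
    and card: "CARD('n::{finite,linorder}) = m + 1"
  obtains Q :: "real ^ 'n::{finite,linorder} ^ 'n::{finite,linorder}" and \<epsilon> :: real
  where "Q \<in> Gram g" "\<epsilon> > 0" "\<And>v. \<epsilon> * (v \<bullet> v) \<le> v \<bullet> (Q *v v)"
proof -
  obtain \<epsilon> where \<epsilon>: "\<epsilon> > 0" "\<And>x. \<epsilon> * (\<Sum>i\<le>m. x ^ (2 * i)) \<le> poly g x"
    using pos_poly_ge_sum_even_powers[OF pos deg] by blast
  define s :: "real poly" where "s = (\<Sum>i\<le>m. monom 1 (2 * i))"
  have poly_s: "poly s x = (\<Sum>i\<le>m. x ^ (2 * i))" for x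
    by (simp add: s_def poly_sum poly_monom)
  have "degree s \<le> 2 * m"
    unfolding s_def by (intro degree_sum_le order_trans[OF degree_monom_le]) auto
  then have "degree (g - smult \<epsilon> s) \<le> 2 * m"
    using deg by (intro degree_diff_le order_trans[OF degree_smult_le]) auto
  moreover have "0 \<le> poly (g - smult \<epsilon> s) x" for x
    using \<epsilon>(2)[of x] by (simp add: poly_s)
  ultimately obtain P :: "real ^ 'n::{finite,linorder} ^ 'n::{finite,linorder}"
    where P: "P \<in> Gram_psd (g - smult \<epsilon> s)"
    using nonneg_poly_Gram_psd_nonempty card by blast
  let ?Q = "P + \<epsilon> *\<^sub>R mat 1"
  have Qv: "v \<bullet> (?Q *v w) = v \<bullet> (P *v w) + \<epsilon> * (v \<bullet> w)" for v w
    by (simp add: matrix_vector_mult_add_rdistrib scaleR_matrix_vector_assoc[symmetric] inner_add_right)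
  have "monomials x \<bullet> (monomials x :: real ^ 'n::{finite,linorder}) = poly s x" for x
  proof -
    have "monomials x \<bullet> (monomials x :: real ^ 'n::{finite,linorder}) =
        (\<Sum>i\<in>(UNIV :: 'n set). x ^ (2 * exponent i))"
      by (simp add: monomials_def inner_vec_def mult_2 power_add)
    also have "\<dots> = (\<Sum>k<CARD('n). x ^ (2 * k))"
      by (rule sum_exponent)
    also have "\<dots> = poly s x"
      by (simp add: poly_s card lessThan_Suc_atMost)
    finally show ?thesis .
  qed
  moreover have "transpose ?Q = ?Q"
    using P by (simp add: Gram_psd_def Gram_iff transpose_def vec_eq_iff mat_def)
  ultimately have "?Q \<in> Gram g"
    using P by (simp add: Gram_psd_def Gram_iff Qv[simplified] diff_eq_eq)
  moreover have "\<epsilon> * (v \<bullet> v) \<le> v \<bullet> (?Q *v v)" for v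
    using P by (simp add: Gram_psd_def pos_semidef_def Qv)
  ultimately show thesis using \<epsilon>(1) that by blast
qed

section \<open>The dimension of the space of Gram matrices of zero\<close>

text \<open>
  \<open>hankel l\<close> is the matrix whose inner product with \<open>Q\<close> reads off the coefficient of \<open>x\<^sup>l\<close> in the
  polynomial of \<open>Q\<close>, and \<open>skew (i, j)\<close> measures the failure of symmetry at the entry \<open>(i, j)\<close>.
\<close>

definition hankel :: "nat \<Rightarrow> real ^ 'n::{finite,linorder} ^ 'n::{finite,linorder}" where
  "hankel l = (\<chi> i j. if exponent i + exponent j = l then 1 else 0)"

definition skew :: "'n \<times> 'n \<Rightarrow> real ^ 'n ^ 'n" where
  "skew p = axis (fst p) (axis (snd p) 1) - axis (snd p) (axis (fst p) 1)"

lemma inner_skew: "skew (i, j) \<bullet> Q = Q $ i $ j - Q $ j $ i"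
  by (simp add: skew_def inner_diff_left inner_axis')

lemma inner_hankel: "hankel l \<bullet> Q = coeff (gram_poly Q) l"
  by (simp add: hankel_def gram_poly_def coeff_sum inner_vec_def if_distrib[of "\<lambda>c. c * _"] cong: if_cong)

lemma orthogonal_skew_hankel: "orthogonal (skew p) (hankel l)"
proof (cases p)
  case (Pair i j)
  then show ?thesis by (simp add: orthogonal_def inner_skew) (simp add: hankel_def add.commute)
qed

lemma orthogonal_hankel: "l \<noteq> l' \<Longrightarrow> orthogonal (hankel l) (hankel l')"
  by (auto simp: orthogonal_def inner_vec_def hankel_def intro!: sum.neutral)

lemma orthogonal_skew:
  fixes i j i' j' :: "'n::{finite,linorder}"
  assumes "i < j" "i' < j'" "(i, j) \<noteq> (i', j')"
  shows "orthogonal (skew (i, j)) (skew (i', j'))"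
  using assms by (auto simp: orthogonal_def inner_skew) (auto simp: skew_def axis_def)

lemma skew_nonzero: "i \<noteq> j \<Longrightarrow> skew (i, j) \<noteq> 0"
  using inner_skew[of i j "skew (i, j)"] by (auto simp: skew_def axis_def)

lemma hankel_nonzero:
  assumes "CARD('n::{finite,linorder}) = m + 1" "l \<le> 2 * m"
  shows "(hankel l :: real ^ 'n::{finite,linorder} ^ 'n::{finite,linorder}) \<noteq> 0"
proof -
  (* l is the sum of two exponents that are both at most m *)
  obtain i :: "'n::{finite,linorder}" where i: "exponent i = min l m"
    by (rule exponent_onto[of "min l m"]) (use assms in auto)
  obtain j :: "'n::{finite,linorder}" where j: "exponent j = l - min l m"
    by (rule exponent_onto[of "l - min l m"]) (use assms in auto)
  have "hankel l $ i $ j = (1 :: real)" by (simp add: hankel_def i j)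
  then show ?thesis by auto
qed

text \<open>For a fixed larger component \<open>j\<close> there are \<open>exponent j\<close> pairs.\<close>

lemma card_less_pairs: "card {(i, j :: 'n::{finite,linorder}). i < j} = CARD('n) choose 2"
proof -
  have "{(i, j :: 'n). i < j} = (\<lambda>(j, i). (i, j)) ` (SIGMA j : UNIV. {i. i < j})"
    by force
  then have "card {(i, j :: 'n). i < j} = card (SIGMA j : (UNIV :: 'n set). {i. i < j})"
    by (simp add: card_image inj_on_def)
  also have "\<dots> = (\<Sum>j\<in>(UNIV :: 'n set). exponent j)"
    by (simp add: exponent_def)
  also have "\<dots> = (\<Sum>k<CARD('n). k)" by (rule sum_exponent)
  also have "\<dots> = CARD('n) choose 2"
    by (simp add: choose_two Sum_Ico_nat flip: atLeast0LessThan)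
  finally show ?thesis .
qed

lemma dim_span_orthogonal_family:
  fixes b :: "'i \<Rightarrow> 'a::euclidean_space"
  assumes "finite I" and nonzero: "\<And>i. i \<in> I \<Longrightarrow> b i \<noteq> 0"
    and orth: "\<And>i j. i \<in> I \<Longrightarrow> j \<in> I \<Longrightarrow> i \<noteq> j \<Longrightarrow> orthogonal (b i) (b j)"
  shows "dim (span (b ` I)) = card I"
proof -
  have "inj_on b I"
    by (rule inj_onI) (metis nonzero orth orthogonal_self)
  moreover have "independent (b ` I)"
    by (rule pairwise_orthogonal_independent) (use nonzero orth in \<open>auto simp: pairwise_def\<close>)
  ultimately show ?thesis by (simp add: dim_eq_card_independent card_image)
qed

lemma Gram_zero_iff_orthogonal:
  fixes Q :: "real ^ 'n::{finite,linorder} ^ 'n::{finite,linorder}"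
  assumes card: "CARD('n) = m + 1"
  shows "Q \<in> Gram 0 \<longleftrightarrow> (\<forall>l\<le>2 * m. orthogonal (hankel l) Q) \<and> (\<forall>i j. i < j \<longrightarrow> orthogonal (skew (i, j)) Q)"
proof -
  have exp: "exponent (i :: 'n::{finite,linorder}) \<le> m" for i
    using exponent_less[of i] card by simp
  have "degree (gram_poly Q) \<le> 2 * m"
    unfolding gram_poly_def mult_2
    by (intro degree_sum_le order_trans[OF degree_monom_le] add_mono exp finite)
  then have "coeff (gram_poly Q) l = 0" if "\<not> l \<le> 2 * m" for l
    using that by (intro coeff_eq_0) simp
  then have "0 = gram_poly Q \<longleftrightarrow> (\<forall>l\<le>2 * m. orthogonal (hankel l) Q)"
    by (auto simp: poly_eq_iff orthogonal_def inner_hankel)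
  moreover have "transpose Q = Q \<longleftrightarrow> (\<forall>i j. i < j \<longrightarrow> Q $ i $ j = Q $ j $ i)"
  proof
    assume "transpose Q = Q"
    then have "transpose Q $ j $ i = Q $ j $ i" for i j by simp
    then show "\<forall>i j. i < j \<longrightarrow> Q $ i $ j = Q $ j $ i" by (simp add: transpose_def)
  next
    assume upper: "\<forall>i j. i < j \<longrightarrow> Q $ i $ j = Q $ j $ i"
    have "Q $ j $ i = Q $ i $ j" for i j
      using upper[rule_format, of i j] upper[rule_format, of j i]
      by (cases i j rule: linorder_cases) simp_all
    then show "transpose Q = Q" by (simp add: transpose_def vec_eq_iff)
  qed
  moreover have "orthogonal (skew (i, j)) Q \<longleftrightarrow> Q $ i $ j = Q $ j $ i" for i j
    by (simp add: orthogonal_def inner_skew)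
  ultimately show ?thesis
    unfolding Gram_iff_gram_poly by blast
qed

text \<open>
  The conditions cutting out the Gram matrices of \<open>0\<close> are orthogonality to the matrices \<open>hankel l\<close>
  and \<open>skew (i, j)\<close>. These are nonzero and pairwise orthogonal, hence independent, so each of them
  lowers the dimension \<open>(m + 1)\<^sup>2\<close> by one.
\<close>

lemma dim_Gram_zero:
  assumes card: "CARD('n::{finite,linorder}) = m + 1"
  shows "dim (Gram 0 :: (real ^ 'n::{finite,linorder} ^ 'n::{finite,linorder}) set) = m choose 2"
proof -
  let ?b = "case_sum hankel skew :: nat + 'n \<times> 'n \<Rightarrow> real ^ 'n::{finite,linorder} ^ 'n::{finite,linorder}"
  let ?I = "{..2 * m} <+> {(i, j :: 'n::{finite,linorder}). i < j}"
  have "dim (span (?b ` ?I)) = card ?I"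
  proof (rule dim_span_orthogonal_family)
    show "?b x \<noteq> 0" if "x \<in> ?I" for x
      using that hankel_nonzero[OF card] by (auto simp: skew_nonzero)
    show "orthogonal (?b x) (?b y)" if "x \<in> ?I" "y \<in> ?I" "x \<noteq> y" for x y
      using that
      by (auto simp: orthogonal_skew_hankel orthogonal_commute[of "hankel _" "skew _"]
          intro: orthogonal_hankel orthogonal_skew)
  qed auto
  also have "card ?I = 2 * m + 1 + (m + 1 choose 2)"
    by (simp add: card_Plus card_less_pairs card)
  finally have family: "dim (span (?b ` ?I)) = 2 * m + 1 + (m + 1 choose 2)" .
  have "Q \<in> Gram 0 \<longleftrightarrow> (\<forall>x\<in>span (?b ` ?I). orthogonal x Q)" for Q
  proof -
    have "(\<forall>x\<in>span (?b ` ?I). orthogonal x Q) \<longleftrightarrow> (\<forall>x\<in>?b ` ?I. orthogonal x Q)"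
      using orthogonal_to_span[of _ "?b ` ?I" Q] span_base[of _ "?b ` ?I"]
      unfolding orthogonal_commute[of Q] by blast
    then show ?thesis
      unfolding Gram_zero_iff_orthogonal[OF card] by (simp add: Plus_def ball_Un Ball_def[of "{.._}"])
  qed
  then have Gram_zero: "Gram 0 = {Q \<in> UNIV. \<forall>x\<in>span (?b ` ?I). orthogonal x Q}" by auto
  then have "dim (Gram 0 :: (real ^ 'n::{finite,linorder} ^ 'n::{finite,linorder}) set) + (2 * m + 1 + (m + 1 choose 2)) =
      (m + 1) * (m + 1)"
    using dim_subspace_orthogonal_to_vectors[OF subspace_span subspace_UNIV subset_UNIV, of "?b ` ?I"]
    unfolding Gram_zero family by (simp add: card)
  moreover have "(m + 1 choose 2) = (m choose 2) + m"
    using choose_reduce_nat[of "m + 1" 2] by simp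
  moreover have "2 * (m choose 2) + m = m * m"
    by (induction m) (simp_all add: numeral_2_eq_2)
  ultimately show ?thesis by (simp add: algebra_simps)
qed

text \<open>
  All differences of Gram matrices of \<open>g\<close> are Gram matrices of \<open>0\<close>. Conversely, a positive definite
  Gram matrix of \<open>g\<close> stays positive semidefinite after a small step in any of these directions, so
  the differences span that whole space.
\<close>

lemma aff_dim_Gram_psd_pos:
  assumes pos: "\<And>x. 0 < poly g x" and deg: "degree g = 2 * m"
    and card: "CARD('n::{finite,linorder}) = m + 1"
  shows "aff_dim (Gram_psd g :: (real ^ 'n::{finite,linorder} ^ 'n::{finite,linorder}) set) = int (m choose 2)"
proof -
  let ?S = "Gram_psd g :: (real ^ 'n::{finite,linorder} ^ 'n::{finite,linorder}) set"
  let ?K = "Gram 0 :: (real ^ 'n::{finite,linorder} ^ 'n::{finite,linorder}) set"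
  obtain Q :: "real ^ 'n::{finite,linorder} ^ 'n::{finite,linorder}" and \<epsilon>
    where Q: "Q \<in> Gram g" and "\<epsilon> > 0" and Q_ge: "\<And>v. \<epsilon> * (v \<bullet> v) \<le> v \<bullet> (Q *v v)"
    using pos_poly_pos_def_Gram[OF pos deg card] by blast
  have "0 \<le> v \<bullet> (Q *v v)" for v
    using Q_ge[of v] \<open>\<epsilon> > 0\<close> by (meson inner_ge_zero less_imp_le mult_nonneg_nonneg order_trans)
  with Q have "Q \<in> ?S" by (simp add: Gram_psd_def Gram_iff pos_semidef_def)
  then have aff: "aff_dim ?S = int (dim ((\<lambda>P. P - Q) ` ?S))"
    by (intro aff_dim_eq_dim_subtract hull_inc)
  have sub: "(\<lambda>P. P - Q) ` ?S \<subseteq> ?K"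
    using Q by (auto simp: Gram_psd_def Gram_iff matrix_vector_mult_diff_rdistrib inner_diff_right
        transpose_def vec_eq_iff)
  have "K \<in> span ((\<lambda>P. P - Q) ` ?S)" if K: "K \<in> ?K" for K
  proof -
    obtain B where "B > 0" and B: "\<And>v. norm (K *v v) \<le> norm v * B"
      using bounded_linear.pos_bounded[OF matrix_vector_mul_bounded_linear[of K]] by blast
    let ?P = "Q + (\<epsilon> / B) *\<^sub>R K"
    have form: "v \<bullet> (?P *v w) = v \<bullet> (Q *v w) + (\<epsilon> / B) * (v \<bullet> (K *v w))" for v w
      by (simp add: matrix_vector_mult_add_rdistrib scaleR_matrix_vector_assoc[symmetric] inner_add_right)
    have "0 \<le> v \<bullet> (?P *v v)" for v
    proof -
      have "\<bar>v \<bullet> (K *v v)\<bar> \<le> norm v * (norm v * B)"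
        using Cauchy_Schwarz_ineq2[of v "K *v v"] mult_left_mono[OF B norm_ge_zero] by (rule order_trans)
      also have "\<dots> = B * (v \<bullet> v)"
        by (simp add: dot_square_norm power2_eq_square)
      finally have "- (B * (v \<bullet> v)) \<le> v \<bullet> (K *v v)" by linarith
      then have "(\<epsilon> / B) * - (B * (v \<bullet> v)) \<le> (\<epsilon> / B) * (v \<bullet> (K *v v))"
        using \<open>\<epsilon> > 0\<close> \<open>B > 0\<close> by (intro mult_left_mono) auto
      then show ?thesis
        using Q_ge[of v] \<open>B > 0\<close> by (simp add: form)
    qed
    moreover have "transpose ?P = ?P"
      using Q K by (simp add: Gram_iff transpose_def vec_eq_iff)
    ultimately have "?P \<in> ?S"
      using Q K by (simp add: Gram_psd_def Gram_iff pos_semidef_def form)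
    then have "?P - Q \<in> span ((\<lambda>P. P - Q) ` ?S)" by (intro span_base imageI)
    then have "(B / \<epsilon>) *\<^sub>R (?P - Q) \<in> span ((\<lambda>P. P - Q) ` ?S)" by (rule span_scale)
    moreover have "(B / \<epsilon>) *\<^sub>R (?P - Q) = K"
      using \<open>\<epsilon> > 0\<close> \<open>B > 0\<close> by simp
    ultimately show ?thesis by simp
  qed
  then have "?K \<subseteq> span ((\<lambda>P. P - Q) ` ?S)" ..
  from dim_subset[OF this] dim_subset[OF sub] have "dim ((\<lambda>P. P - Q) ` ?S) = dim ?K"
    unfolding dim_span by (intro antisym)
  with aff show ?thesis by (simp add: dim_Gram_zero[OF card])
qed

section \<open>The spectrahedra of \<open>f\<close> and \<open>g\<close>\<close>

theorem theorem3p1: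
  fixes f g :: "real poly" and d k e :: nat and r :: "nat \<Rightarrow> real" and es :: "nat \<Rightarrow> nat"
  assumes "degree f = 2 * d"
    and "\<forall>x. poly f x \<ge> 0"
    and "f = (\<Prod>i=1..k. [:- r i, 1:] ^ (2 * es i)) * g"
    and "e = (\<Sum>i=1..k. es i)"
    and "degree g = 2 * (d - e)"
    and "\<forall>x. poly g x > 0"
    and "CARD('n::{finite,linorder}) = d + 1"
    and "CARD('m::{finite,linorder}) = d - e + 1"
  shows "affinely_isomorphic (Gram_psd f :: (real ^ 'n::{finite,linorder} ^ 'n::{finite,linorder}) set) (Gram_psd g :: (real ^ 'm::{finite,linorder} ^ 'm::{finite,linorder}) set)
    \<and> aff_dim (Gram_psd f :: (real ^ 'n::{finite,linorder} ^ 'n::{finite,linorder}) set) = aff_dim (Gram_psd g :: (real ^ 'm::{finite,linorder} ^ 'm::{finite,linorder}) set)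
    \<and> aff_dim (Gram_psd g :: (real ^ 'm::{finite,linorder} ^ 'm::{finite,linorder}) set) = int ((d - e) choose 2)"
proof -
  define F where "F = (\<Prod>i=1..k. [:- r i, 1:] ^ es i)"
  have f: "f = F\<^sup>2 * g"
    unfolding assms(3) F_def by (simp only: prod_power_distrib power_mult[symmetric] mult.commute[of 2])
  have "degree F = e"
    unfolding F_def assms(4) by (subst degree_prod_eq_sum_degree) (auto simp: degree_linear_power)
  have "g \<noteq> 0" using assms(6) by auto
  have F: "dvd_by_bound F" unfolding F_def by (rule dvd_by_bound_real_rooted)
  then have "F \<noteq> 0" by (simp add: dvd_by_bound_def)
  (* comparing degrees shows e \<le> d, so that the truncated difference d - e is the true one *)
  then have "2 * d = 2 * e + 2 * (d - e)"
    using \<open>g \<noteq> 0\<close> assms(1,5) \<open>degree F = e\<close> by (simp add: f degree_mult_eq degree_power_eq)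
  then have card: "CARD('n) = CARD('m) + degree F"
    using assms(7,8) \<open>degree F = e\<close> by simp
  have "aff_dim (Gram_psd g :: (real ^ 'm::{finite,linorder} ^ 'm::{finite,linorder}) set) = int ((d - e) choose 2)"
    using assms(5,6,8) by (intro aff_dim_Gram_psd_pos) auto
  then show ?thesis
    unfolding f using affinely_isomorphic_Gram_psd_square_mult[OF card F, of g] by blast
qed

end
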